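(* Let $r,s$ be non-negative integers and $n,k,\lambda$ positive integers with $\max\{r,s\}\le n\le k$. Let $\boldsymbol\rho=(\rho_1,\dots,\rho_k)$ be a $k$-tuple of integers with $1\le\rho_\ell\le\lambda n$ for each $\ell\in[k]$ and $\sum_{\ell\in[k]}\rho_\ell=\lambda n^2$. An $r\times s$ $(\boldsymbol\rho,\lambda)$-Latin rectangle $M$ can be extended to an $n\times n$ $(\boldsymbol\rho,\lambda)$-Latin square if and only if $M$ is admissible.
   Context: Notation: $[m]=\{1,\dots,m\}$ (so $[0]=\varnothing$); $x\,\dot{-}\,y:=\max\{0,x-y\}$; for $K\subseteq[k]$, $\bar K=[k]\setminus K$. Arrays: an $r\times s$ $\lambda$-matrix $M$ on the symbol set $[k]$ is an $r\times s$ array in which each cell $(i,j)$ contains a multiset of exactly $\lambda$ elements of $[k]$. For $\ell\in[k]$, $i\in[r]$, $j\in[s]$, write $|M_\ell|$, $|M^i_\ell|$, $|{}^jM_\ell|$ for the number of occurrences (with multiplicity) of $\ell$ in $M$, in row $i$ of $M$, and in column $j$ of $M$, respectively. For $K\subseteq[k]$, $|M^i_K|=\sum_{\ell\in K}|M^i_\ell|$ and $|{}^jM_K|=\sum_{\ell\in K}|{}^jM_\ell|$. An $n\times n$ $(\boldsymbol\rho,\lambda)$-Latin square is an $n\times n$ $\lambda$-matrix $N$ on $[k]$ with $|N_\ell|=\rho_\ell$, $|N^i_\ell|\le\lambda$, $|{}^jN_\ell|\le\lambda$ for all $\ell\in[k]$, $i,j\in[n]$. An $r\times s$ $(\boldsymbol\rho,\lambda)$-Latin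 rectangle is an $r\times s$ $\lambda$-matrix $M$ on $[k]$ with $|M_\ell|\le\rho_\ell$, $|M^i_\ell|\le\lambda$, $|{}^jM_\ell|\le\lambda$ for all $\ell\in[k]$, $i\in[r]$, $j\in[s]$. $M$ is extended to $N$ if $M$ is the top left $r\times s$ subarray of $N$. Admissibility: given an $r\times s$ $(\boldsymbol\rho,\lambda)$-Latin rectangle $M$, put, for $\ell\in[k]$, $$\alpha_\ell:=(\rho_\ell-|M_\ell|+\lambda r)\,\dot{-}\,\lambda n,\qquad \beta_\ell:=(\rho_\ell-|M_\ell|+\lambda s)\,\dot{-}\,\lambda n.$$ $M$ is admissible if there exists a sequence $\{(a_\ell,b_\ell)\}_{\ell=1}^k$ of pairs of non-negative integers such that all of the following hold: (1) $\sum_{\ell\in[k]}a_\ell=\lambda r(n-s)-\sum_{\ell\in[k]}\alpha_\ell$; (2) $\sum_{\ell\in[k]}b_\ell=\lambda s(n-r)-\sum_{\ell\in[k]}\beta_\ell$; (3) $a_\ell\le\lambda r-|M_\ell|-\alpha_\ell$ for all $\ell\in[k]$; (4) $b_\ell\le\lambda s-|M_\ell|-\beta_\ell$ for all $\ell\in[k]$; (5) $a_\ell+b_\ell\le\rho_\ell-|M_\ell|-\alpha_\ell-\beta_\ell$ for all $\ell\in[k]$; (6) $\sum_{i\in[r]}\big((\lambda n-\lambda s+|M^i_K|)\,\dot{-}\,\lambda|K|\big)\le\sum_{\ell\in\bar K}(a_\ell+\alpha_\ell)$ for all $K\subseteq[k]$; (7) $\sum_{j\in[s]}\big((\lambda n-\lambda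 r+|{}^jM_K|)\,\dot{-}\,\lambda|K|\big)\le\sum_{\ell\in\bar K}(b_\ell+\beta_\ell)$ for all $K\subseteq[k]$. *)

theory Defs
  imports Main "HOL-Library.Multiset"
begin

text \<open>Rows, columns and symbols are numbered from 1. An array is a total function; only its
  values on the cells in \<open>{1..r} \<times> {1..s}\<close> are meaningful.\<close>

type_synonym array = "nat \<Rightarrow> nat \<Rightarrow> nat multiset"

definition lam_matrix :: "nat \<Rightarrow> nat \<Rightarrow> nat \<Rightarrow> nat \<Rightarrow> array \<Rightarrow> bool" where
  "lam_matrix r s k lam M \<longleftrightarrow>
     (\<forall>i\<in>{1..r}. \<forall>j\<in>{1..s}. size (M i j) = lam \<and> set_mset (M i j) \<subseteq> {1..k})"

definition row_occ :: "nat \<Rightarrow> array \<Rightarrow> nat \<Rightarrow> nat \<Rightarrow> nat" where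
  "row_occ s M i l = (\<Sum>j\<in>{1..s}. count (M i j) l)"

definition col_occ :: "nat \<Rightarrow> array \<Rightarrow> nat \<Rightarrow> nat \<Rightarrow> nat" where
  "col_occ r M j l = (\<Sum>i\<in>{1..r}. count (M i j) l)"

definition occ :: "nat \<Rightarrow> nat \<Rightarrow> array \<Rightarrow> nat \<Rightarrow> nat" where
  "occ r s M l = (\<Sum>i\<in>{1..r}. \<Sum>j\<in>{1..s}. count (M i j) l)"

definition row_occ_set :: "nat \<Rightarrow> array \<Rightarrow> nat \<Rightarrow> nat set \<Rightarrow> nat" where
  "row_occ_set s M i K = (\<Sum>l\<in>K. row_occ s M i l)"

definition col_occ_set :: "nat \<Rightarrow> array \<Rightarrow> nat \<Rightarrow> nat set \<Rightarrow> nat" where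
  "col_occ_set r M j K = (\<Sum>l\<in>K. col_occ r M j l)"

definition latin_square :: "nat \<Rightarrow> nat \<Rightarrow> (nat \<Rightarrow> int) \<Rightarrow> nat \<Rightarrow> array \<Rightarrow> bool" where
  "latin_square n k \<rho> lam N \<longleftrightarrow>
     lam_matrix n n k lam N \<and>
     (\<forall>l\<in>{1..k}. int (occ n n N l) = \<rho> l) \<and>
     (\<forall>l\<in>{1..k}. \<forall>i\<in>{1..n}. row_occ n N i l \<le> lam) \<and>
     (\<forall>l\<in>{1..k}. \<forall>j\<in>{1..n}. col_occ n N j l \<le> lam)"

definition latin_rectangle ::
    "nat \<Rightarrow> nat \<Rightarrow> nat \<Rightarrow> (nat \<Rightarrow> int) \<Rightarrow> nat \<Rightarrow> array \<Rightarrow> bool" where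
  "latin_rectangle r s k \<rho> lam M \<longleftrightarrow>
     lam_matrix r s k lam M \<and>
     (\<forall>l\<in>{1..k}. int (occ r s M l) \<le> \<rho> l) \<and>
     (\<forall>l\<in>{1..k}. \<forall>i\<in>{1..r}. row_occ s M i l \<le> lam) \<and>
     (\<forall>l\<in>{1..k}. \<forall>j\<in>{1..s}. col_occ r M j l \<le> lam)"

definition extends :: "nat \<Rightarrow> nat \<Rightarrow> array \<Rightarrow> array \<Rightarrow> bool" where
  "extends r s M N \<longleftrightarrow> (\<forall>i\<in>{1..r}. \<forall>j\<in>{1..s}. N i j = M i j)"

definition monus :: "int \<Rightarrow> int \<Rightarrow> int" where
  "monus x y = max 0 (x - y)"

definition alpha ::
    "nat \<Rightarrow> nat \<Rightarrow> nat \<Rightarrow> (nat \<Rightarrow> int) \<Rightarrow> nat \<Rightarrow> array \<Rightarrow> nat \<Rightarrow> int" where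
  "alpha r s n \<rho> lam M l =
     monus (\<rho> l - int (occ r s M l) + int lam * int r) (int lam * int n)"

definition beta ::
    "nat \<Rightarrow> nat \<Rightarrow> nat \<Rightarrow> (nat \<Rightarrow> int) \<Rightarrow> nat \<Rightarrow> array \<Rightarrow> nat \<Rightarrow> int" where
  "beta r s n \<rho> lam M l =
     monus (\<rho> l - int (occ r s M l) + int lam * int s) (int lam * int n)"

definition admissible ::
    "nat \<Rightarrow> nat \<Rightarrow> nat \<Rightarrow> nat \<Rightarrow> (nat \<Rightarrow> int) \<Rightarrow> nat \<Rightarrow> array \<Rightarrow> bool" where
  "admissible r s n k \<rho> lam M \<longleftrightarrow>
     (\<exists>a b :: nat \<Rightarrow> int.
        (\<forall>l\<in>{1..k}. 0 \<le> a l \<and> 0 \<le> b l) \<and>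
        (\<Sum>l\<in>{1..k}. a l) =
          int lam * int r * (int n - int s) - (\<Sum>l\<in>{1..k}. alpha r s n \<rho> lam M l) \<and>
        (\<Sum>l\<in>{1..k}. b l) =
          int lam * int s * (int n - int r) - (\<Sum>l\<in>{1..k}. beta r s n \<rho> lam M l) \<and>
        (\<forall>l\<in>{1..k}. a l \<le> int lam * int r - int (occ r s M l) - alpha r s n \<rho> lam M l) \<and>
        (\<forall>l\<in>{1..k}. b l \<le> int lam * int s - int (occ r s M l) - beta r s n \<rho> lam M l) \<and>
        (\<forall>l\<in>{1..k}. a l + b l \<le>
          \<rho> l - int (occ r s M l) - alpha r s n \<rho> lam M l - beta r s n \<rho> lam M l) \<and>
        (\<forall>K. K \<subseteq> {1..k} \<longrightarrow>
          (\<Sum>i\<in>{1..r}. monus (int lam * int n - int lam * int s + int (row_occ_set s M i K))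
                           (int lam * int (card K)))
          \<le> (\<Sum>l\<in>{1..k} - K. a l + alpha r s n \<rho> lam M l)) \<and>
        (\<forall>K. K \<subseteq> {1..k} \<longrightarrow>
          (\<Sum>j\<in>{1..s}. monus (int lam * int n - int lam * int r + int (col_occ_set r M j K))
                           (int lam * int (card K)))
          \<le> (\<Sum>l\<in>{1..k} - K. b l + beta r s n \<rho> lam M l)))"

end

theory Submission
  imports Defs
begin

text \<open>
  The idea is to reduce an extension to its outline and then to show that every outline can be
  resolved. In a square \<open>N\<close> extending \<open>M\<close>, merge the columns beyond \<open>s\<close> into one and the rows
  beyond \<open>r\<close> into one. What remains is \<open>M\<close> together with the numbers \<open>x i l\<close> of symbols \<open>l\<close> in row
  \<open>i\<close> to the right of \<open>M\<close>, the numbers \<open>y j l\<close> of symbols \<open>l\<close> in column \<open>j\<close> below \<open>M\<close>, and the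
  numbers \<open>D l\<close> of symbols \<open>l\<close> in the corner. Three facts make up the proof.

  First, admissibility says exactly that such an outline exists, with the obvious numerical
  constraints (\<open>admissible_iff_profiles\<close>). The column totals of \<open>x\<close> and of \<open>y\<close> are
  \<open>a l + \<alpha> l\<close> and \<open>b l + \<beta> l\<close>; the lower bounds \<open>\<alpha>\<close> and \<open>\<beta>\<close> say that what is left of a
  symbol fits into the remaining rows or columns. The two families of inequalities over
  subsets \<open>K\<close> are the Hall-type conditions for distributing these totals over the rows or over the
  columns (\<open>row_profile_iff\<close>), which are sufficient by the supply-demand theorem for bipartite
  networks (\<open>supply_demand\<close>).

  Second, merging rows and columns of \<open>N\<close> yields an outline, hence \<open>M\<close> is admissible.

  Third, an outline is resolved in two steps, each of which splits a bipartite multigraph into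
  colour classes of prescribed degrees (\<open>bounded_decomposition\<close>). In the first step the
  vertices are the rows \<open>1, \<dots>, r\<close>, the merged row, and the symbols; the colours are the columns
  beyond \<open>s\<close>. In the second step the vertices are all \<open>n\<close> columns and the symbols, an edge being an
  occurrence of a symbol in the merged row; the colours are the rows beyond \<open>r\<close>. A colour class is
  one new column or one new row. The decomposition exists because the classes can be split off one
  at a time: dividing all multiplicities by the number of colours gives a fractional class, so no
  cut obstructs an integral one.
\<close>

section \<open>The supply-demand theorem for bipartite networks\<close>

text \<open>Consider the network with arcs from a source to \<open>i\<close> of capacity \<open>p i\<close>, from \<open>i\<close> to \<open>l\<close> of
  capacity \<open>u (i, l)\<close>, and from \<open>l\<close> to a sink of capacity \<open>q l\<close>. This is the capacity of
  the cut whose source side contains \<open>S \<union> T\<close>, minus \<open>sum p I\<close>, the capacity of the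
  trivial cut around the source.\<close>

definition cut_slack ::
    "'a set \<Rightarrow> 'b set \<Rightarrow> ('a \<Rightarrow> int) \<Rightarrow> ('b \<Rightarrow> int) \<Rightarrow> ('a \<times> 'b \<Rightarrow> int) \<Rightarrow> 'a set \<Rightarrow> 'b set \<Rightarrow> int" where
  "cut_slack I L p q u S T =
     sum q T - sum p S + (\<Sum>e\<in>I \<times> L. if fst e \<in> S \<and> snd e \<notin> T then u e else 0)"

text \<open>Cut capacities are submodular. The inequality is strict because the arc \<open>e\<close> leads from
  \<open>S2 - S1\<close> to \<open>T1 - T2\<close>: it leaves the source side of the second cut, but crosses
  neither the union nor the intersection.\<close>

lemma cut_slack_uncrossing:
  fixes u :: "'a \<times> 'b \<Rightarrow> int"
  assumes "finite I" "finite L" "\<And>e. e \<in> I \<times> L \<Longrightarrow> 0 \<le> u e"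
    and "S1 \<subseteq> I" "S2 \<subseteq> I" "T1 \<subseteq> L" "T2 \<subseteq> L"
    and e: "e \<in> I \<times> L" "0 < u e" "fst e \<in> S2 - S1" "snd e \<in> T1 - T2"
  shows "cut_slack I L p q u (S1 \<union> S2) (T1 \<union> T2) + cut_slack I L p q u (S1 \<inter> S2) (T1 \<inter> T2)
       < cut_slack I L p q u S1 T1 + cut_slack I L p q u S2 T2"
proof -
  define g where "g S T e = (if fst e \<in> S \<and> snd e \<notin> T then u e else 0)" for S T e
  have fin: "finite S1" "finite S2" "finite T1" "finite T2"
    using assms finite_subset by blast+
  have "(\<Sum>e\<in>I \<times> L. g (S1 \<union> S2) (T1 \<union> T2) e + g (S1 \<inter> S2) (T1 \<inter> T2) e)
      < (\<Sum>e\<in>I \<times> L. g S1 T1 e + g S2 T2 e)"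
  proof (rule sum_strict_mono_ex1)
    show "\<forall>e\<in>I \<times> L. g (S1 \<union> S2) (T1 \<union> T2) e + g (S1 \<inter> S2) (T1 \<inter> T2) e \<le> g S1 T1 e + g S2 T2 e"
      using assms(3) by (auto simp: g_def)
    have "g (S1 \<union> S2) (T1 \<union> T2) e + g (S1 \<inter> S2) (T1 \<inter> T2) e < g S1 T1 e + g S2 T2 e"
      using e by (auto simp: g_def)
    then show "\<exists>e\<in>I \<times> L. g (S1 \<union> S2) (T1 \<union> T2) e + g (S1 \<inter> S2) (T1 \<inter> T2) e < g S1 T1 e + g S2 T2 e"
      using e(1) by blast
  qed (use assms in simp)
  moreover have "sum p (S1 \<union> S2) + sum p (S1 \<inter> S2) = sum p S1 + sum p S2"
      "sum q (T1 \<union> T2) + sum q (T1 \<inter> T2) = sum q T1 + sum q T2"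
    using fin sum.union_inter by blast+
  ultimately show ?thesis
    unfolding cut_slack_def g_def[symmetric] by (simp add: sum.distrib)
qed

lemma sum_change_one:
  fixes f g :: "'a \<Rightarrow> int"
  assumes "finite A" "a \<in> A" "\<And>x. x \<in> A \<Longrightarrow> x \<noteq> a \<Longrightarrow> f x = g x"
  shows "sum f A = sum g A + (f a - g a)"
proof -
  have "sum f (A - {a}) = sum g (A - {a})" using assms(3) by (intro sum.cong) auto
  then show ?thesis using assms(1,2) by (simp add: sum.remove[of A a])
qed

text \<open>Induction on the total capacity. Take an arc \<open>(i, l)\<close> of positive capacity. Lowering its
  capacity by one preserves the cut condition unless some tight cut is crossed by the arc. Sending
  one unit along the arc (so that its capacity, the supply of \<open>i\<close> and the demand of \<open>l\<close> all drop
  by one) preserves it unless some tight cut has \<open>l\<close>, but not \<open>i\<close>, on its source side. Both kinds of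
  tight cut cannot occur together, as uncrossing them would give a cut of negative slack.

  The cut condition includes nonnegativity of \<open>p\<close> and \<open>q\<close>, through the cuts with
  \<open>S = I - {i}, T = L\<close> and with \<open>S = {}, T = {l}\<close>.\<close>

lemma supply_demand:
  fixes p :: "'a \<Rightarrow> int" and q :: "'b \<Rightarrow> int" and u :: "'a \<times> 'b \<Rightarrow> int"
  assumes fin: "finite I" "finite L"
    and u: "\<And>e. e \<in> I \<times> L \<Longrightarrow> 0 \<le> u e"
    and bal: "sum p I = sum q L"
    and cut: "\<And>S T. S \<subseteq> I \<Longrightarrow> T \<subseteq> L \<Longrightarrow> 0 \<le> cut_slack I L p q u S T"
  shows "\<exists>x. (\<forall>e\<in>I \<times> L. 0 \<le> x e \<and> x e \<le> u e) \<and>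
             (\<forall>i\<in>I. (\<Sum>l\<in>L. x (i, l)) = p i) \<and> (\<forall>l\<in>L. (\<Sum>i\<in>I. x (i, l)) = q l)"
  using u bal cut
proof (induction "nat (sum u (I \<times> L))" arbitrary: p q u rule: less_induct)
  case less
  note u = less.prems(1) and bal = less.prems(2) and cut = less.prems(3)
  have p0: "0 \<le> p i" if "i \<in> I" for i
  proof -
    have "(\<Sum>e\<in>I \<times> L. if fst e \<in> I - {i} \<and> snd e \<notin> L then u e else 0) = 0"
      by (rule sum.neutral) auto
    then have "cut_slack I L p q u (I - {i}) L = p i"
      using that fin bal by (simp add: cut_slack_def sum_diff1)
    then show ?thesis using cut[of "I - {i}" L] by simp
  qed
  have q0: "0 \<le> q l" if "l \<in> L" for l
    using cut[of "{}" "{l}"] that by (simp add: cut_slack_def)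
  show ?case
  proof (cases "\<exists>e\<in>I \<times> L. 0 < u e")
    case False
    then have u0: "u e = 0" if "e \<in> I \<times> L" for e using u that by force
    have "cut_slack I L p q u I {} = - sum p I"
      by (auto simp: cut_slack_def u0 intro!: sum.neutral)
    then have "sum p I \<le> 0" using cut[of I "{}"] by simp
    then have "p i = 0" if "i \<in> I" for i
      using that p0 fin by (metis sum_nonneg_eq_0_iff sum_nonneg order_antisym)
    moreover have "q l = 0" if "l \<in> L" for l
      using that q0 fin \<open>sum p I \<le> 0\<close> bal by (metis sum_nonneg_eq_0_iff sum_nonneg order_antisym)
    ultimately show ?thesis using u by (intro exI[of _ "\<lambda>_. 0"]) simp
  next
    case True
    then obtain i l where il: "i \<in> I" "l \<in> L" "0 < u (i, l)" by auto
    define u' where "u' = u((i, l) := u (i, l) - 1)"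
    have usum: "sum u' (I \<times> L) = sum u (I \<times> L) - 1"
      using fin il by (subst sum_change_one[of "I \<times> L" "(i, l)" u' u]) (auto simp: u'_def)
    moreover have "0 < sum u (I \<times> L)"
      using fin il u sum_pos2[of "I \<times> L" "(i, l)" u] by simp
    ultimately have dec: "nat (sum u' (I \<times> L)) < nat (sum u (I \<times> L))" by simp
    have u': "0 \<le> u' e" if "e \<in> I \<times> L" for e using u[OF that] il by (auto simp: u'_def)
    have cap: "(\<Sum>e\<in>I \<times> L. if fst e \<in> S \<and> snd e \<notin> T then u' e else 0)
             = (\<Sum>e\<in>I \<times> L. if fst e \<in> S \<and> snd e \<notin> T then u e else 0)
               - (if i \<in> S \<and> l \<notin> T then 1 else 0)" for S T
      using fin il by (subst sum_change_one[of "I \<times> L" "(i, l)" _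
            "\<lambda>e. if fst e \<in> S \<and> snd e \<notin> T then u e else 0"]) (auto simp: u'_def)
    \<comment> \<open>In the first case the unit of capacity is superfluous, in the second it carries flow.\<close>
    show ?thesis
    proof (cases "\<exists>S T. S \<subseteq> I \<and> T \<subseteq> L \<and> i \<in> S \<and> l \<notin> T \<and> cut_slack I L p q u S T = 0")
      case False
      have "0 \<le> cut_slack I L p q u' S T" if "S \<subseteq> I" "T \<subseteq> L" for S T
      proof -
        have "cut_slack I L p q u S T \<noteq> 0" if "i \<in> S \<and> l \<notin> T"
          using False that \<open>S \<subseteq> I\<close> \<open>T \<subseteq> L\<close> by blast
        then show ?thesis using cut[OF that] by (auto simp: cut_slack_def cap)
      qed
      from less.hyps[OF dec u' bal this] obtain x where
        x: "\<forall>e\<in>I \<times> L. 0 \<le> x e \<and> x e \<le> u' e"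
           "\<forall>i\<in>I. (\<Sum>l\<in>L. x (i, l)) = p i" "\<forall>l\<in>L. (\<Sum>i\<in>I. x (i, l)) = q l" by blast
      have "u' e \<le> u e" for e by (simp add: u'_def)
      then have "\<forall>e\<in>I \<times> L. 0 \<le> x e \<and> x e \<le> u e" using x(1) by (meson order_trans)
      with x(2,3) show ?thesis by blast
    next
      case True
      then obtain S2 T2 where t2: "S2 \<subseteq> I" "T2 \<subseteq> L" "i \<in> S2" "l \<notin> T2" "cut_slack I L p q u S2 T2 = 0"
        by blast
      define p' where "p' = p(i := p i - 1)"
      define q' where "q' = q(l := q l - 1)"
      have sp: "sum p' S = sum p S - (if i \<in> S then 1 else 0)" if "S \<subseteq> I" for S
      proof (cases "i \<in> S")
        case True
        then show ?thesis
          using finite_subset[OF that] fin by (subst sum_change_one[of S i p' p]) (auto simp: p'_def)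
      next
        case False
        then have "sum p' S = sum p S" by (intro sum.cong) (auto simp: p'_def)
        then show ?thesis using False by simp
      qed
      have sq: "sum q' T = sum q T - (if l \<in> T then 1 else 0)" if "T \<subseteq> L" for T
      proof (cases "l \<in> T")
        case True
        then show ?thesis
          using finite_subset[OF that] fin by (subst sum_change_one[of T l q' q]) (auto simp: q'_def)
      next
        case False
        then have "sum q' T = sum q T" by (intro sum.cong) (auto simp: q'_def)
        then show ?thesis using False by simp
      qed
      have cut': "0 \<le> cut_slack I L p' q' u' S T" if ST: "S \<subseteq> I" "T \<subseteq> L" for S T
      proof -
        have "cut_slack I L p q u S T \<noteq> 0" if "i \<notin> S" "l \<in> T"
        proof
          assume "cut_slack I L p q u S T = 0"
          then have "cut_slack I L p q u (S \<union> S2) (T \<union> T2) + cut_slack I L p q u (S \<inter> S2) (T \<inter> T2) < 0"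
            using cut_slack_uncrossing[of I L u S S2 T T2 "(i, l)" p q] fin u ST t2 il that by auto
          moreover have "0 \<le> cut_slack I L p q u (S \<union> S2) (T \<union> T2)"
            using cut ST t2 by simp
          moreover have "0 \<le> cut_slack I L p q u (S \<inter> S2) (T \<inter> T2)"
            using cut ST t2 by (simp add: le_infI1)
          ultimately show False by linarith
        qed
        moreover have "cut_slack I L p' q' u' S T
            = cut_slack I L p q u S T - (if i \<notin> S \<and> l \<in> T then 1 else 0)"
          by (auto simp: cut_slack_def cap sp sq ST)
        ultimately show ?thesis using cut[OF ST] by auto
      qed
      have bal': "sum p' I = sum q' L" using bal sp[of I] sq[of L] il by simp
      from less.hyps[OF dec u' bal' cut'] obtain x where
        x: "\<forall>e\<in>I \<times> L. 0 \<le> x e \<and> x e \<le> u' e"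
           "\<forall>i\<in>I. (\<Sum>l\<in>L. x (i, l)) = p' i" "\<forall>l\<in>L. (\<Sum>i\<in>I. x (i, l)) = q' l" by blast
      define y where "y = x((i, l) := x (i, l) + 1)"
      have "(\<Sum>l\<in>L. y (i', l)) = p i'" if "i' \<in> I" for i'
      proof -
        have "(\<Sum>l\<in>L. y (i', l)) = (\<Sum>l\<in>L. x (i', l)) + (if i' = i then 1 else 0)"
          using fin il by (subst sum_change_one[of L l _ "\<lambda>l. x (i', l)"]) (auto simp: y_def)
        then show ?thesis using x(2) that by (auto simp: p'_def)
      qed
      moreover have "(\<Sum>i\<in>I. y (i, l')) = q l'" if "l' \<in> L" for l'
      proof -
        have "(\<Sum>i\<in>I. y (i, l')) = (\<Sum>i\<in>I. x (i, l')) + (if l' = l then 1 else 0)"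
          using fin il by (subst sum_change_one[of I i _ "\<lambda>i. x (i, l')"]) (auto simp: y_def)
        then show ?thesis using x(3) that by (auto simp: q'_def)
      qed
      moreover have "0 \<le> y e \<and> y e \<le> u e" if "e \<in> I \<times> L" for e
        using x(1) that by (fastforce simp: y_def u'_def split: if_splits)
      ultimately show ?thesis by (intro exI[of _ y]) blast
    qed
  qed
qed

lemma cut_slack_altdef:
  fixes u :: "'a \<times> 'b \<Rightarrow> int"
  assumes "finite I" "finite L" "S \<subseteq> I" "T \<subseteq> L"
  shows "cut_slack I L p q u S T = sum q T - sum p S + (\<Sum>i\<in>S. \<Sum>l\<in>L - T. u (i, l))"
proof -
  have "(\<Sum>i\<in>S. \<Sum>l\<in>L - T. u (i, l)) = (\<Sum>e\<in>S \<times> (L - T). u e)"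
    by (simp add: sum.cartesian_product)
  also have "S \<times> (L - T) = {e \<in> I \<times> L. fst e \<in> S \<and> snd e \<notin> T}"
    using assms by auto
  also have "sum u \<dots> = (\<Sum>e\<in>I \<times> L. if fst e \<in> S \<and> snd e \<notin> T then u e else 0)"
    using assms by (simp add: sum.inter_filter)
  finally show ?thesis by (simp add: cut_slack_def)
qed

section \<open>Splitting a bipartite multigraph into colour classes\<close>

text \<open>The fractional solution \<open>z / m\<close> respects every cut, hence so do the integral supplies \<open>p\<close>
  and demands \<open>q\<close>.\<close>

lemma exact_share:
  fixes z :: "'a \<times> 'b \<Rightarrow> int" and m :: nat
  assumes fin: "finite I" "finite L" and z: "\<And>e. e \<in> I \<times> L \<Longrightarrow> 0 \<le> z e" and m: "0 < m"
    and row: "\<And>i. i \<in> I \<Longrightarrow> (\<Sum>l\<in>L. z (i, l)) = int m * p i"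
    and col: "\<And>l. l \<in> L \<Longrightarrow> (\<Sum>i\<in>I. z (i, l)) = int m * q l"
  shows "\<exists>x. (\<forall>e\<in>I \<times> L. 0 \<le> x e \<and> x e \<le> z e) \<and>
             (\<forall>i\<in>I. (\<Sum>l\<in>L. x (i, l)) = p i) \<and> (\<forall>l\<in>L. (\<Sum>i\<in>I. x (i, l)) = q l)"
proof (rule supply_demand[OF fin z])
  have "int m * sum p I = int m * sum q L"
    using sum.swap[of "\<lambda>i l. z (i, l)" L I] by (simp add: row col sum_distrib_left)
  then show "sum p I = sum q L" using m by simp
next
  fix S T assume ST: "S \<subseteq> I" "T \<subseteq> L"
  have finS: "finite S" using ST fin finite_subset by blast
  have z0: "0 \<le> (\<Sum>i\<in>S. \<Sum>l\<in>L - T. z (i, l))"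
    using ST z by (intro sum_nonneg) blast
  have "int m * sum p S = (\<Sum>i\<in>S. \<Sum>l\<in>L. z (i, l))"
    using ST row by (simp add: sum_distrib_left subset_iff)
  also have "\<dots> = (\<Sum>i\<in>S. \<Sum>l\<in>L - T. z (i, l)) + (\<Sum>i\<in>S. \<Sum>l\<in>T. z (i, l))"
    by (simp add: sum.subset_diff[OF ST(2) fin(2)] sum.distrib)
  also have "(\<Sum>i\<in>S. \<Sum>l\<in>T. z (i, l)) = (\<Sum>l\<in>T. \<Sum>i\<in>S. z (i, l))"
    by (rule sum.swap)
  also have "\<dots> \<le> (\<Sum>l\<in>T. \<Sum>i\<in>I. z (i, l))"
    using ST fin z by (intro sum_mono sum_mono2) auto
  also have "\<dots> = int m * sum q T"
    using ST col by (simp add: sum_distrib_left subset_iff)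
  \<comment> \<open>The first summand is only enlarged, so that the common factor \<open>m\<close> can be cancelled.\<close>
  also have "(\<Sum>i\<in>S. \<Sum>l\<in>L - T. z (i, l)) \<le> int m * (\<Sum>i\<in>S. \<Sum>l\<in>L - T. z (i, l))"
    using mult_right_mono[OF _ z0, of 1 "int m"] m by simp
  finally have "0 \<le> int m * (sum q T - sum p S + (\<Sum>i\<in>S. \<Sum>l\<in>L - T. z (i, l)))"
    by (simp add: algebra_simps)
  then show "0 \<le> cut_slack I L p q z S T"
    using m cut_slack_altdef[OF fin ST] by (simp add: zero_le_mult_iff)
qed

text \<open>Read \<open>z (i, l)\<close> as the multiplicity of the edge \<open>{i, l}\<close>, \<open>C\<close> as a set of colours and \<open>w c\<close>
  as the class of colour \<open>c\<close>. Removing an exact share leaves a multigraph that satisfies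
  the hypotheses with one colour less.\<close>

lemma exact_decomposition:
  fixes z :: "'a \<times> 'b \<Rightarrow> int"
  assumes "finite C" and fin: "finite I" "finite L" and "\<And>e. e \<in> I \<times> L \<Longrightarrow> 0 \<le> z e"
    and "\<And>i. i \<in> I \<Longrightarrow> (\<Sum>l\<in>L. z (i, l)) = int (card C) * p i"
    and "\<And>l. l \<in> L \<Longrightarrow> (\<Sum>i\<in>I. z (i, l)) = int (card C) * q l"
  shows "\<exists>w. (\<forall>c\<in>C. \<forall>e\<in>I \<times> L. 0 \<le> w c e) \<and> (\<forall>e\<in>I \<times> L. (\<Sum>c\<in>C. w c e) = z e) \<and>
             (\<forall>c\<in>C. \<forall>i\<in>I. (\<Sum>l\<in>L. w c (i, l)) = p i) \<and>
             (\<forall>c\<in>C. \<forall>l\<in>L. (\<Sum>i\<in>I. w c (i, l)) = q l)"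
  using assms(1,4-)
proof (induction C arbitrary: z rule: finite_induct)
  case empty
  have "z (i, l) = 0" if "i \<in> I" "l \<in> L" for i l
    using empty(1,2) that fin sum_nonneg_eq_0_iff[of L "\<lambda>l. z (i, l)"] by simp
  then show ?case by auto
next
  case (insert c C)
  have "0 < card (insert c C)" using insert(1) by (simp add: card_gt_0_iff)
  from exact_share[OF fin insert.prems(1) this insert.prems(2,3)] obtain x where
    x: "\<forall>e\<in>I \<times> L. 0 \<le> x e \<and> x e \<le> z e"
       "\<forall>i\<in>I. (\<Sum>l\<in>L. x (i, l)) = p i" "\<forall>l\<in>L. (\<Sum>i\<in>I. x (i, l)) = q l" by blast
  have "\<exists>w. (\<forall>c\<in>C. \<forall>e\<in>I \<times> L. 0 \<le> w c e) \<and> (\<forall>e\<in>I \<times> L. (\<Sum>c\<in>C. w c e) = z e - x e) \<and>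
             (\<forall>c\<in>C. \<forall>i\<in>I. (\<Sum>l\<in>L. w c (i, l)) = p i) \<and>
             (\<forall>c\<in>C. \<forall>l\<in>L. (\<Sum>i\<in>I. w c (i, l)) = q l)"
  proof (rule insert.IH)
    show "0 \<le> z e - x e" if "e \<in> I \<times> L" for e
      using x(1) that by (metis diff_ge_0_iff_ge)
    show "(\<Sum>l\<in>L. z (i, l) - x (i, l)) = int (card C) * p i" if "i \<in> I" for i
      using x(2) that insert.prems(2) insert(1,2) by (simp add: sum_subtractf algebra_simps)
    show "(\<Sum>i\<in>I. z (i, l) - x (i, l)) = int (card C) * q l" if "l \<in> L" for l
      using x(3) that insert.prems(3) insert(1,2) by (simp add: sum_subtractf algebra_simps)
  qed
  then obtain w where
    w: "\<forall>c\<in>C. \<forall>e\<in>I \<times> L. 0 \<le> w c e" "\<forall>e\<in>I \<times> L. (\<Sum>c\<in>C. w c e) = z e - x e"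
       "\<forall>c\<in>C. \<forall>i\<in>I. (\<Sum>l\<in>L. w c (i, l)) = p i"
       "\<forall>c\<in>C. \<forall>l\<in>L. (\<Sum>i\<in>I. w c (i, l)) = q l" by blast
  have "(\<Sum>c'\<in>C. (w(c := x)) c' e) = (\<Sum>c'\<in>C. w c' e)" for e
    using insert(2) by (intro sum.cong) auto
  then have "\<forall>e\<in>I \<times> L. (\<Sum>c'\<in>insert c C. (w(c := x)) c' e) = z e"
    using w(2) insert(1,2) by (simp del: fun_upd_apply add: fun_upd_same)
  with w x show ?case by (intro exI[of _ "w(c := x)"]) auto
qed

text \<open>One extra vertex \<open>None\<close>, joined to each \<open>l\<close> by as many edges as its degree falls short of
  \<open>card C * q l\<close>, turns the bounds on the degrees of the \<open>l\<close> into equations. The degree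
  of \<open>None\<close> is automatically divisible by the number of colours.\<close>

lemma bounded_decomposition:
  fixes z :: "'a \<Rightarrow> 'b \<Rightarrow> int"
  assumes "finite C" and fin: "finite I" "finite L" and z: "\<And>i l. i \<in> I \<Longrightarrow> l \<in> L \<Longrightarrow> 0 \<le> z i l"
    and row: "\<And>i. i \<in> I \<Longrightarrow> (\<Sum>l\<in>L. z i l) = int (card C) * p i"
    and col: "\<And>l. l \<in> L \<Longrightarrow> (\<Sum>i\<in>I. z i l) \<le> int (card C) * q l"
  shows "\<exists>w. (\<forall>c\<in>C. \<forall>i\<in>I. \<forall>l\<in>L. 0 \<le> w c i l) \<and>
             (\<forall>i\<in>I. \<forall>l\<in>L. (\<Sum>c\<in>C. w c i l) = z i l) \<and>
             (\<forall>c\<in>C. \<forall>i\<in>I. (\<Sum>l\<in>L. w c i l) = p i) \<and>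
             (\<forall>c\<in>C. \<forall>l\<in>L. (\<Sum>i\<in>I. w c i l) \<le> q l)"
proof -
  define I' where "I' = insert None (Some ` I)"
  define z' where "z' = (\<lambda>(i, l). case i of Some i \<Rightarrow> z i l
    | None \<Rightarrow> int (card C) * q l - (\<Sum>i\<in>I. z i l))"
  define p' where "p' i = (case i of Some i \<Rightarrow> p i | None \<Rightarrow> sum q L - sum p I)" for i
  have sumI': "(\<Sum>i\<in>I'. f i) = f None + (\<Sum>i\<in>I. f (Some i))" for f :: "'a option \<Rightarrow> int"
    using fin by (simp add: I'_def sum.reindex)
  have "\<exists>w. (\<forall>c\<in>C. \<forall>e\<in>I' \<times> L. 0 \<le> w c e) \<and> (\<forall>e\<in>I' \<times> L. (\<Sum>c\<in>C. w c e) = z' e) \<and>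
             (\<forall>c\<in>C. \<forall>i\<in>I'. (\<Sum>l\<in>L. w c (i, l)) = p' i) \<and>
             (\<forall>c\<in>C. \<forall>l\<in>L. (\<Sum>i\<in>I'. w c (i, l)) = q l)"
  proof (rule exact_decomposition)
    show "finite I'" using fin by (simp add: I'_def)
    show "0 \<le> z' e" if "e \<in> I' \<times> L" for e
      using that z col by (auto simp: I'_def z'_def)
    have "(\<Sum>l\<in>L. \<Sum>i\<in>I. z i l) = int (card C) * sum p I"
      using sum.swap[of "\<lambda>i l. z i l" L I] by (simp add: row sum_distrib_left)
    then show "(\<Sum>l\<in>L. z' (i, l)) = int (card C) * p' i" if "i \<in> I'" for i
      using that row by (auto simp: I'_def z'_def p'_def sum_subtractf right_diff_distrib simp flip: sum_distrib_left)
    show "(\<Sum>i\<in>I'. z' (i, l)) = int (card C) * q l" for l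
      by (simp add: sumI' z'_def)
  qed (use assms in auto)
  then obtain w where
    w: "\<forall>c\<in>C. \<forall>e\<in>I' \<times> L. 0 \<le> w c e" "\<forall>e\<in>I' \<times> L. (\<Sum>c\<in>C. w c e) = z' e"
       "\<forall>c\<in>C. \<forall>i\<in>I'. (\<Sum>l\<in>L. w c (i, l)) = p' i"
       "\<forall>c\<in>C. \<forall>l\<in>L. (\<Sum>i\<in>I'. w c (i, l)) = q l" by blast
  have "(\<Sum>i\<in>I. w c (Some i, l)) \<le> q l" if "c \<in> C" "l \<in> L" for c l
  proof -
    have "0 \<le> w c (None, l)" using w(1) that by (auto simp: I'_def)
    moreover have "w c (None, l) + (\<Sum>i\<in>I. w c (Some i, l)) = q l"
      using w(4) that sumI'[of "\<lambda>i. w c (i, l)"] by simp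
    ultimately show ?thesis by linarith
  qed
  with w(1-3) show ?thesis
    by (intro exI[of _ "\<lambda>c i l. w c (Some i, l)"]) (auto simp: I'_def z'_def p'_def)
qed

section \<open>Admissibility as the existence of an outline\<close>

text \<open>Each row \<open>i\<close> has to receive \<open>d\<close> further symbols, of which at most \<open>lam - h i l\<close> are \<open>l\<close>,
  and \<open>A l\<close> is the prescribed total of \<open>l\<close>. Symbols in \<open>K\<close> contribute at most
  \<open>lam * card K - (\<Sum>l\<in>K. h i l)\<close> to row \<open>i\<close>, and the symbols outside \<open>K\<close> must make up the
  rest. Conversely, a cut of the network is given by a set \<open>S\<close> of rows and a set \<open>L - K\<close> of
  symbols; truncating the difference at zero and summing over all rows accounts for the worst
  choice of \<open>S\<close>, so the condition involves \<open>K\<close> only.\<close>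

lemma row_profile_iff:
  fixes h :: "'a \<Rightarrow> 'b \<Rightarrow> int"
  assumes fin: "finite I" "finite L" and h: "\<And>i l. i \<in> I \<Longrightarrow> l \<in> L \<Longrightarrow> h i l \<le> lam"
    and bal: "sum A L = int (card I) * d"
  shows "(\<exists>x. (\<forall>i\<in>I. \<forall>l\<in>L. 0 \<le> x i l \<and> h i l + x i l \<le> lam) \<and>
              (\<forall>i\<in>I. (\<Sum>l\<in>L. x i l) = d) \<and> (\<forall>l\<in>L. (\<Sum>i\<in>I. x i l) = A l)) \<longleftrightarrow>
         (\<forall>K\<subseteq>L. (\<Sum>i\<in>I. monus (d + (\<Sum>l\<in>K. h i l)) (lam * int (card K))) \<le> sum A (L - K))"
    (is "?lhs \<longleftrightarrow> ?rhs")
proof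
  assume ?lhs
  then obtain x where x: "\<And>i l. i \<in> I \<Longrightarrow> l \<in> L \<Longrightarrow> 0 \<le> x i l \<and> h i l + x i l \<le> lam"
    "\<And>i. i \<in> I \<Longrightarrow> (\<Sum>l\<in>L. x i l) = d" "\<And>l. l \<in> L \<Longrightarrow> (\<Sum>i\<in>I. x i l) = A l" by blast
  show ?rhs
  proof (intro allI impI)
    fix K assume K: "K \<subseteq> L"
    have "monus (d + (\<Sum>l\<in>K. h i l)) (lam * int (card K)) \<le> (\<Sum>l\<in>L - K. x i l)" if i: "i \<in> I" for i
    proof -
      have "(\<Sum>l\<in>K. h i l + x i l) \<le> int (card K) * lam"
        using K x(1)[OF i] by (intro sum_bounded_above) auto
      moreover have "(\<Sum>l\<in>L - K. x i l) + (\<Sum>l\<in>K. x i l) = d"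
        using x(2)[OF i] sum.subset_diff[OF K fin(2)] by metis
      moreover have "0 \<le> (\<Sum>l\<in>L - K. x i l)" using x(1)[OF i] by (intro sum_nonneg) auto
      ultimately show ?thesis by (simp add: monus_def sum.distrib algebra_simps)
    qed
    then have "(\<Sum>i\<in>I. monus (d + (\<Sum>l\<in>K. h i l)) (lam * int (card K)))
        \<le> (\<Sum>i\<in>I. \<Sum>l\<in>L - K. x i l)" by (rule sum_mono)
    also have "\<dots> = sum A (L - K)" using x(3) by (subst sum.swap) simp
    finally show "(\<Sum>i\<in>I. monus (d + (\<Sum>l\<in>K. h i l)) (lam * int (card K))) \<le> sum A (L - K)" .
  qed
next
  assume rhs: ?rhs
  have "\<exists>x. (\<forall>e\<in>I \<times> L. 0 \<le> x e \<and> x e \<le> (case e of (i, l) \<Rightarrow> lam - h i l)) \<and>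
             (\<forall>i\<in>I. (\<Sum>l\<in>L. x (i, l)) = d) \<and> (\<forall>l\<in>L. (\<Sum>i\<in>I. x (i, l)) = A l)"
  proof (rule supply_demand[OF fin])
    show "0 \<le> (case e of (i, l) \<Rightarrow> lam - h i l)" if "e \<in> I \<times> L" for e
      using that h by auto
    show "(\<Sum>i\<in>I. d) = sum A L" using bal by simp
    fix S T assume ST: "S \<subseteq> I" "T \<subseteq> L"
    have "(\<Sum>i\<in>S. d - (\<Sum>l\<in>L - T. lam - h i l))
        \<le> (\<Sum>i\<in>S. monus (d + (\<Sum>l\<in>L - T. h i l)) (lam * int (card (L - T))))"
      by (intro sum_mono) (simp add: monus_def sum_subtractf algebra_simps)
    also have "\<dots> \<le> (\<Sum>i\<in>I. monus (d + (\<Sum>l\<in>L - T. h i l)) (lam * int (card (L - T))))"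
      using ST fin by (intro sum_mono2) (auto simp: monus_def)
    also have "\<dots> \<le> sum A (L - (L - T))" using rhs by blast
    also have "L - (L - T) = T" using ST by blast
    finally show "0 \<le> cut_slack I L (\<lambda>_. d) A (\<lambda>(i, l). lam - h i l) S T"
      by (simp add: cut_slack_altdef[OF fin ST] sum_subtractf)
  qed
  then obtain x where "\<forall>e\<in>I \<times> L. 0 \<le> x e \<and> x e \<le> (case e of (i, l) \<Rightarrow> lam - h i l)"
    "\<forall>i\<in>I. (\<Sum>l\<in>L. x (i, l)) = d" "\<forall>l\<in>L. (\<Sum>i\<in>I. x (i, l)) = A l" by blast
  then show ?lhs by (intro exI[of _ "\<lambda>i l. x (i, l)"]) fastforce
qed

text \<open>The correspondence is \<open>(\<Sum>i\<in>{1..r}. x i l) = a l + \<alpha> l\<close> and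
  \<open>(\<Sum>j\<in>{1..s}. y j l) = b l + \<beta> l\<close>. As \<open>\<alpha> l\<close> and \<open>\<beta> l\<close> are truncated
  differences, nonnegativity of \<open>a\<close> and \<open>b\<close> amounts to that of the totals and to the lower
  bounds on them in the last two inequalities, and the
  conditions over subsets of symbols become the existence of \<open>x\<close> and \<open>y\<close>. The upper
  bounds on \<open>a\<close> and \<open>b\<close> alone are recovered by summing the bounds on the single rows and
  columns.\<close>

lemma admissible_iff_profiles:
  fixes r s n k lam :: nat and \<rho> :: "nat \<Rightarrow> int" and M :: array
  assumes rect: "latin_rectangle r s k \<rho> lam M"
  shows "admissible r s n k \<rho> lam M \<longleftrightarrow>
    (\<exists>x y :: nat \<Rightarrow> nat \<Rightarrow> int.
      (\<forall>i\<in>{1..r}. \<forall>l\<in>{1..k}. 0 \<le> x i l \<and> int (row_occ s M i l) + x i l \<le> int lam) \<and>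
      (\<forall>i\<in>{1..r}. (\<Sum>l\<in>{1..k}. x i l) = int lam * int n - int lam * int s) \<and>
      (\<forall>j\<in>{1..s}. \<forall>l\<in>{1..k}. 0 \<le> y j l \<and> int (col_occ r M j l) + y j l \<le> int lam) \<and>
      (\<forall>j\<in>{1..s}. (\<Sum>l\<in>{1..k}. y j l) = int lam * int n - int lam * int r) \<and>
      (\<forall>l\<in>{1..k}.
        (\<Sum>i\<in>{1..r}. x i l) + (\<Sum>j\<in>{1..s}. y j l) \<le> \<rho> l - int (occ r s M l) \<and>
        \<rho> l - int (occ r s M l) - (\<Sum>i\<in>{1..r}. x i l) \<le> int lam * int n - int lam * int r \<and>
        \<rho> l - int (occ r s M l) - (\<Sum>j\<in>{1..s}. y j l) \<le> int lam * int n - int lam * int s))"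
    (is "?adm \<longleftrightarrow> ?prof")
proof -
  define m where "m l = int (occ r s M l)" for l
  define al where "al = alpha r s n \<rho> lam M"
  define be where "be = beta r s n \<rho> lam M"
  have al: "al l = max 0 (\<rho> l - m l + int lam * int r - int lam * int n)" for l
    by (simp add: al_def m_def alpha_def monus_def)
  have be: "be l = max 0 (\<rho> l - m l + int lam * int s - int lam * int n)" for l
    by (simp add: be_def m_def beta_def monus_def)
  have m_row: "m l = (\<Sum>i\<in>{1..r}. int (row_occ s M i l))" for l
    by (simp add: m_def occ_def row_occ_def)
  have m_col: "m l = (\<Sum>j\<in>{1..s}. int (col_occ r M j l))" for l
    unfolding m_def occ_def col_occ_def by (subst sum.swap) simp
  have ro: "int (row_occ s M i l) \<le> int lam" if "i \<in> {1..r}" "l \<in> {1..k}" for i l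
    using rect that by (simp add: latin_rectangle_def)
  have co: "int (col_occ r M j l) \<le> int lam" if "j \<in> {1..s}" "l \<in> {1..k}" for j l
    using rect that by (simp add: latin_rectangle_def)
  note profile_x = row_profile_iff[of "{1..r}" "{1..k}" "\<lambda>i l. int (row_occ s M i l)" "int lam"
      _ "int lam * int n - int lam * int s", OF finite_atLeastAtMost finite_atLeastAtMost ro]
  note profile_y = row_profile_iff[of "{1..s}" "{1..k}" "\<lambda>j l. int (col_occ r M j l)" "int lam"
      _ "int lam * int n - int lam * int r", OF finite_atLeastAtMost finite_atLeastAtMost co]
  show ?thesis
  proof
    assume ?adm
    then obtain a b where
      ab0: "\<forall>l\<in>{1..k}. 0 \<le> a l \<and> 0 \<le> b l" and
      sa: "(\<Sum>l\<in>{1..k}. a l) = int lam * int r * (int n - int s) - (\<Sum>l\<in>{1..k}. al l)" and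
      sb: "(\<Sum>l\<in>{1..k}. b l) = int lam * int s * (int n - int r) - (\<Sum>l\<in>{1..k}. be l)" and
      ab: "\<forall>l\<in>{1..k}. a l + b l \<le> \<rho> l - m l - al l - be l" and
      ha: "\<forall>K. K \<subseteq> {1..k} \<longrightarrow>
          (\<Sum>i\<in>{1..r}. monus (int lam * int n - int lam * int s + int (row_occ_set s M i K))
                           (int lam * int (card K)))
          \<le> (\<Sum>l\<in>{1..k} - K. a l + al l)" and
      hb: "\<forall>K. K \<subseteq> {1..k} \<longrightarrow>
          (\<Sum>j\<in>{1..s}. monus (int lam * int n - int lam * int r + int (col_occ_set r M j K))
                           (int lam * int (card K)))
          \<le> (\<Sum>l\<in>{1..k} - K. b l + be l)"
      unfolding admissible_def al_def[symmetric] be_def[symmetric] m_def[symmetric]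
      by (elim exE conjE) (rule that; assumption)
    have "\<exists>x. (\<forall>i\<in>{1..r}. \<forall>l\<in>{1..k}. 0 \<le> x i l \<and> int (row_occ s M i l) + x i l \<le> int lam) \<and>
        (\<forall>i\<in>{1..r}. (\<Sum>l\<in>{1..k}. x i l) = int lam * int n - int lam * int s) \<and>
        (\<forall>l\<in>{1..k}. (\<Sum>i\<in>{1..r}. x i l) = a l + al l)"
      using ha sa by (subst profile_x) (auto simp: row_occ_set_def sum.distrib algebra_simps)
    then obtain x where x:
        "\<forall>i\<in>{1..r}. \<forall>l\<in>{1..k}. 0 \<le> x i l \<and> int (row_occ s M i l) + x i l \<le> int lam"
        "\<forall>i\<in>{1..r}. (\<Sum>l\<in>{1..k}. x i l) = int lam * int n - int lam * int s"
        "\<forall>l\<in>{1..k}. (\<Sum>i\<in>{1..r}. x i l) = a l + al l" by blast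
    have "\<exists>y. (\<forall>j\<in>{1..s}. \<forall>l\<in>{1..k}. 0 \<le> y j l \<and> int (col_occ r M j l) + y j l \<le> int lam) \<and>
        (\<forall>j\<in>{1..s}. (\<Sum>l\<in>{1..k}. y j l) = int lam * int n - int lam * int r) \<and>
        (\<forall>l\<in>{1..k}. (\<Sum>j\<in>{1..s}. y j l) = b l + be l)"
      using hb sb by (subst profile_y) (auto simp: col_occ_set_def sum.distrib algebra_simps)
    then obtain y where y:
        "\<forall>j\<in>{1..s}. \<forall>l\<in>{1..k}. 0 \<le> y j l \<and> int (col_occ r M j l) + y j l \<le> int lam"
        "\<forall>j\<in>{1..s}. (\<Sum>l\<in>{1..k}. y j l) = int lam * int n - int lam * int r"
        "\<forall>l\<in>{1..k}. (\<Sum>j\<in>{1..s}. y j l) = b l + be l" by blast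
    have "a l + al l + (b l + be l) \<le> \<rho> l - m l \<and>
        \<rho> l - m l - (a l + al l) \<le> int lam * int n - int lam * int r \<and>
        \<rho> l - m l - (b l + be l) \<le> int lam * int n - int lam * int s" if "l \<in> {1..k}" for l
      using bspec[OF ab0 that] bspec[OF ab that] al[of l] be[of l] by linarith
    then show ?prof
      unfolding m_def[symmetric] using x y by (intro exI[of _ x] exI[of _ y]) simp
  next
    assume ?prof
    then obtain x y where
      x: "\<forall>i\<in>{1..r}. \<forall>l\<in>{1..k}. 0 \<le> x i l \<and> int (row_occ s M i l) + x i l \<le> int lam"
        "\<forall>i\<in>{1..r}. (\<Sum>l\<in>{1..k}. x i l) = int lam * int n - int lam * int s" and
      y: "\<forall>j\<in>{1..s}. \<forall>l\<in>{1..k}. 0 \<le> y j l \<and> int (col_occ r M j l) + y j l \<le> int lam"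
        "\<forall>j\<in>{1..s}. (\<Sum>l\<in>{1..k}. y j l) = int lam * int n - int lam * int r" and
      xy: "\<forall>l\<in>{1..k}.
        (\<Sum>i\<in>{1..r}. x i l) + (\<Sum>j\<in>{1..s}. y j l) \<le> \<rho> l - m l \<and>
        \<rho> l - m l - (\<Sum>i\<in>{1..r}. x i l) \<le> int lam * int n - int lam * int r \<and>
        \<rho> l - m l - (\<Sum>j\<in>{1..s}. y j l) \<le> int lam * int n - int lam * int s"
      unfolding m_def by blast
    define A where "A l = (\<Sum>i\<in>{1..r}. x i l)" for l
    define B where "B l = (\<Sum>j\<in>{1..s}. y j l)" for l
    have A0: "0 \<le> A l" if "l \<in> {1..k}" for l using x(1) that by (auto simp: A_def intro!: sum_nonneg)
    have B0: "0 \<le> B l" if "l \<in> {1..k}" for l using y(1) that by (auto simp: B_def intro!: sum_nonneg)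
    have sumA: "sum A {1..k} = int r * (int lam * int n - int lam * int s)"
      using x(2) unfolding A_def by (subst sum.swap) simp
    have sumB: "sum B {1..k} = int s * (int lam * int n - int lam * int r)"
      using y(2) unfolding B_def by (subst sum.swap) simp
    have Ale: "A l \<le> int lam * int r - m l" if "l \<in> {1..k}" for l
    proof -
      have "(\<Sum>i\<in>{1..r}. int (row_occ s M i l) + x i l) \<le> int (card {1..r}) * int lam"
        using x(1) that by (intro sum_bounded_above) blast
      then show ?thesis by (simp add: A_def m_row sum.distrib algebra_simps)
    qed
    have Ble: "B l \<le> int lam * int s - m l" if "l \<in> {1..k}" for l
    proof -
      have "(\<Sum>j\<in>{1..s}. int (col_occ r M j l) + y j l) \<le> int (card {1..s}) * int lam"
        using y(1) that by (intro sum_bounded_above) blast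
      then show ?thesis by (simp add: B_def m_col sum.distrib algebra_simps)
    qed
    have hallA: "\<forall>K\<subseteq>{1..k}. (\<Sum>i\<in>{1..r}. monus (int lam * int n - int lam * int s +
        (\<Sum>l\<in>K. int (row_occ s M i l))) (int lam * int (card K))) \<le> sum A ({1..k} - K)"
      using x sumA by (subst profile_x[symmetric]) (auto simp: A_def)
    have hallB: "\<forall>K\<subseteq>{1..k}. (\<Sum>j\<in>{1..s}. monus (int lam * int n - int lam * int r +
        (\<Sum>l\<in>K. int (col_occ r M j l))) (int lam * int (card K))) \<le> sum B ({1..k} - K)"
      using y sumB by (subst profile_y[symmetric]) (auto simp: B_def)
    have bounds: "al l \<le> A l \<and> be l \<le> B l \<and> A l + B l \<le> \<rho> l - m l" if "l \<in> {1..k}" for l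
      using bspec[OF xy that] A0[OF that] B0[OF that] al[of l] be[of l]
      unfolding A_def[symmetric] B_def[symmetric] by linarith
    show ?adm
      unfolding admissible_def al_def[symmetric] be_def[symmetric] m_def[symmetric]
    proof (rule exI[of _ "\<lambda>l. A l - al l"], rule exI[of _ "\<lambda>l. B l - be l"], intro conjI)
    qed (use bounds Ale Ble hallA hallB sumA sumB in
        \<open>simp_all add: sum_subtractf row_occ_set_def col_occ_set_def algebra_simps\<close>)
  qed
qed

section \<open>From an extension to its outline\<close>

lemma sum_split_at:
  fixes f :: "nat \<Rightarrow> int"
  assumes "s \<le> n"
  shows "(\<Sum>j\<in>{1..n}. f j) = (\<Sum>j\<in>{1..s}. f j) + (\<Sum>j\<in>{Suc s..n}. f j)"
proof -
  have "{1..n} = {1..s} \<union> {Suc s..n}" using assms by auto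
  then show ?thesis by (simp add: sum.union_disjoint)
qed

lemma size_eq_sum_count:
  assumes "finite L" "set_mset X \<subseteq> L"
  shows "(\<Sum>l\<in>L. int (count X l)) = int (size X)"
proof -
  have "size X = (\<Sum>l\<in>L. count X l)"
    unfolding size_multiset_overloaded_eq using assms
    by (intro sum.mono_neutral_left) (auto simp: not_in_iff)
  then show ?thesis by simp
qed

text \<open>\<open>D l\<close> counts the symbol \<open>l\<close> in the corner. Its nonnegativity, together with the bound on \<open>l\<close>
  in the rows beyond \<open>r\<close> and in the columns beyond \<open>s\<close>, gives the numerical constraints
  of the outline.\<close>

lemma extension_imp_admissible:
  fixes r s n k lam :: nat and \<rho> :: "nat \<Rightarrow> int" and M N :: array
  assumes rs: "r \<le> n" "s \<le> n" and rect: "latin_rectangle r s k \<rho> lam M"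
    and sq: "latin_square n k \<rho> lam N" and ext: "extends r s M N"
  shows "admissible r s n k \<rho> lam M"
proof -
  define c where "c i j l = int (count (N i j) l)" for i j l
  have cM: "c i j l = int (count (M i j) l)" if "i \<in> {1..r}" "j \<in> {1..s}" for i j l
    using ext that by (simp add: extends_def c_def)
  have row: "(\<Sum>j\<in>{1..n}. c i j l) \<le> int lam" if "i \<in> {1..n}" "l \<in> {1..k}" for i l
    using sq that by (auto simp: latin_square_def row_occ_def c_def simp flip: of_nat_sum)
  have col: "(\<Sum>i\<in>{1..n}. c i j l) \<le> int lam" if "j \<in> {1..n}" "l \<in> {1..k}" for j l
    using sq that by (auto simp: latin_square_def col_occ_def c_def simp flip: of_nat_sum)
  have tot: "(\<Sum>i\<in>{1..n}. \<Sum>j\<in>{1..n}. c i j l) = \<rho> l" if "l \<in> {1..k}" for l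
    using sq that by (auto simp: latin_square_def occ_def c_def)
  have cell: "(\<Sum>l\<in>{1..k}. c i j l) = int lam" if "i \<in> {1..n}" "j \<in> {1..n}" for i j
    using sq that unfolding c_def
    by (subst size_eq_sum_count) (auto simp: latin_square_def lam_matrix_def)
  have rowM: "int (row_occ s M i l) = (\<Sum>j\<in>{1..s}. c i j l)" if "i \<in> {1..r}" for i l
    using that by (simp add: row_occ_def cM)
  have colM: "int (col_occ r M j l) = (\<Sum>i\<in>{1..r}. c i j l)" if "j \<in> {1..s}" for j l
    using that by (simp add: col_occ_def cM)
  have occM: "int (occ r s M l) = (\<Sum>i\<in>{1..r}. \<Sum>j\<in>{1..s}. c i j l)" for l
    by (simp add: occ_def cM)
  define x where "x i l = (\<Sum>j\<in>{Suc s..n}. c i j l)" for i l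
  define y where "y j l = (\<Sum>i\<in>{Suc r..n}. c i j l)" for j l
  define D where "D l = (\<Sum>i\<in>{Suc r..n}. \<Sum>j\<in>{Suc s..n}. c i j l)" for l
  have B: "(\<Sum>j\<in>{1..s}. y j l) = (\<Sum>i\<in>{Suc r..n}. \<Sum>j\<in>{1..s}. c i j l)" for l
    unfolding y_def by (rule sum.swap)
  have below: "(\<Sum>i\<in>{Suc r..n}. \<Sum>j\<in>{1..n}. c i j l) = (\<Sum>j\<in>{1..s}. y j l) + D l" for l
    unfolding sum_split_at[OF rs(2)] sum.distrib B D_def ..
  have right: "(\<Sum>j\<in>{Suc s..n}. \<Sum>i\<in>{1..n}. c i j l) = (\<Sum>i\<in>{1..r}. x i l) + D l" for l
    unfolding x_def D_def sum_split_at[OF rs(1)] sum.distrib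
    by (simp add: sum.swap[of _ "{Suc s..n}"])
  have parts: "\<rho> l = int (occ r s M l) + (\<Sum>i\<in>{1..r}. x i l) + (\<Sum>j\<in>{1..s}. y j l) + D l"
    if "l \<in> {1..k}" for l
  proof -
    have "(\<Sum>i\<in>{1..r}. \<Sum>j\<in>{1..n}. c i j l) = int (occ r s M l) + (\<Sum>i\<in>{1..r}. x i l)"
      unfolding sum_split_at[OF rs(2)] sum.distrib occM x_def ..
    then show ?thesis
      using tot[OF that] below[of l] sum_split_at[OF rs(1), of "\<lambda>i. \<Sum>j\<in>{1..n}. c i j l"] by linarith
  qed
  have "0 \<le> D l" for l by (auto simp: D_def c_def intro!: sum_nonneg)
  moreover have "(\<Sum>j\<in>{1..s}. y j l) + D l \<le> int lam * int n - int lam * int r" if "l \<in> {1..k}" for l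
  proof -
    have "(\<Sum>i\<in>{Suc r..n}. \<Sum>j\<in>{1..n}. c i j l) \<le> int (card {Suc r..n}) * int lam"
      using row that by (intro sum_bounded_above) auto
    then show ?thesis unfolding below using rs by (simp add: of_nat_diff algebra_simps)
  qed
  moreover have "(\<Sum>i\<in>{1..r}. x i l) + D l \<le> int lam * int n - int lam * int s" if "l \<in> {1..k}" for l
  proof -
    have "(\<Sum>j\<in>{Suc s..n}. \<Sum>i\<in>{1..n}. c i j l) \<le> int (card {Suc s..n}) * int lam"
      using col that by (intro sum_bounded_above) auto
    then show ?thesis unfolding right using rs by (simp add: of_nat_diff algebra_simps)
  qed
  moreover have "0 \<le> x i l \<and> int (row_occ s M i l) + x i l \<le> int lam"
    if "i \<in> {1..r}" "l \<in> {1..k}" for i l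
    using row[of i l] that rs unfolding sum_split_at[OF rs(2)] rowM[OF that(1)]
    by (auto simp: x_def c_def intro!: sum_nonneg)
  moreover have "0 \<le> y j l \<and> int (col_occ r M j l) + y j l \<le> int lam"
    if "j \<in> {1..s}" "l \<in> {1..k}" for j l
    using col[of j l] that rs unfolding sum_split_at[OF rs(1)] colM[OF that(1)]
    by (auto simp: y_def c_def intro!: sum_nonneg)
  moreover have "(\<Sum>l\<in>{1..k}. x i l) = int lam * int n - int lam * int s" if "i \<in> {1..r}" for i
    using that rs cell unfolding x_def by (subst sum.swap) (simp add: of_nat_diff algebra_simps)
  moreover have "(\<Sum>l\<in>{1..k}. y j l) = int lam * int n - int lam * int r" if "j \<in> {1..s}" for j
    using that rs cell unfolding y_def by (subst sum.swap) (simp add: of_nat_diff algebra_simps)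
  ultimately show ?thesis
    unfolding admissible_iff_profiles[OF rect]
    by (intro exI[of _ x] exI[of _ y]) (simp add: parts algebra_simps)
qed

section \<open>From an outline to an extension\<close>

definition mset_of_counts :: "nat set \<Rightarrow> (nat \<Rightarrow> int) \<Rightarrow> nat multiset" where
  "mset_of_counts L f = (\<Sum>l\<in>L. replicate_mset (nat (f l)) l)"

lemma count_mset_of_counts:
  "finite L \<Longrightarrow> count (mset_of_counts L f) l = (if l \<in> L then nat (f l) else 0)"
  by (simp add: mset_of_counts_def count_sum)

lemma set_mset_of_counts: "finite L \<Longrightarrow> set_mset (mset_of_counts L f) \<subseteq> L"
  by (auto simp: count_mset_of_counts simp flip: count_greater_zero_iff split: if_splits)

text \<open>Resolve the merged column first, then the merged row. Row index \<open>0\<close> stands for the merged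
  row in the first decomposition. The bounds on the totals of \<open>x\<close> and \<open>y\<close> are precisely what
  keeps the degree of each symbol within \<open>lam\<close> times the number of colours in both steps.\<close>

lemma admissible_imp_extension:
  fixes r s n k lam :: nat and \<rho> :: "nat \<Rightarrow> int" and M :: array
  assumes rs: "r \<le> n" "s \<le> n" and rect: "latin_rectangle r s k \<rho> lam M"
    and \<rho>: "(\<Sum>l\<in>{1..k}. \<rho> l) = int lam * (int n)\<^sup>2"
    and adm: "admissible r s n k \<rho> lam M"
  shows "\<exists>N. latin_square n k \<rho> lam N \<and> extends r s M N"
proof -
  let ?L = "{1..k}"
  define m where "m l = int (occ r s M l)" for l
  obtain x y where
    x: "\<And>i l. i \<in> {1..r} \<Longrightarrow> l \<in> ?L \<Longrightarrow> 0 \<le> x i l \<and> int (row_occ s M i l) + x i l \<le> int lam"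
      "\<And>i. i \<in> {1..r} \<Longrightarrow> (\<Sum>l\<in>?L. x i l) = int lam * int n - int lam * int s" and
    y: "\<And>j l. j \<in> {1..s} \<Longrightarrow> l \<in> ?L \<Longrightarrow> 0 \<le> y j l \<and> int (col_occ r M j l) + y j l \<le> int lam"
      "\<And>j. j \<in> {1..s} \<Longrightarrow> (\<Sum>l\<in>?L. y j l) = int lam * int n - int lam * int r" and
    xy: "\<And>l. l \<in> ?L \<Longrightarrow>
        (\<Sum>i\<in>{1..r}. x i l) + (\<Sum>j\<in>{1..s}. y j l) \<le> \<rho> l - m l \<and>
        \<rho> l - m l - (\<Sum>i\<in>{1..r}. x i l) \<le> int lam * int n - int lam * int r \<and>
        \<rho> l - m l - (\<Sum>j\<in>{1..s}. y j l) \<le> int lam * int n - int lam * int s"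
    using adm unfolding admissible_iff_profiles[OF rect] m_def by blast
  define A where "A l = (\<Sum>i\<in>{1..r}. x i l)" for l
  define B where "B l = (\<Sum>j\<in>{1..s}. y j l)" for l
  define D where "D l = \<rho> l - m l - A l - B l" for l
  have D0: "0 \<le> D l" and DA: "D l + A l \<le> (int n - int s) * int lam"
    and DB: "D l + B l \<le> (int n - int r) * int lam" if "l \<in> ?L" for l
    using xy[OF that] unfolding D_def A_def[symmetric] B_def[symmetric] by (simp_all add: algebra_simps)
  have cellM: "(\<Sum>l\<in>?L. int (count (M i j) l)) = int lam" "set_mset (M i j) \<subseteq> ?L"
    if "i \<in> {1..r}" "j \<in> {1..s}" for i j
    using rect that size_eq_sum_count[of ?L "M i j"] by (auto simp: latin_rectangle_def lam_matrix_def)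
  have "sum m ?L = (\<Sum>l\<in>?L. \<Sum>i\<in>{1..r}. \<Sum>j\<in>{1..s}. int (count (M i j) l))"
    by (simp add: m_def occ_def)
  also have "\<dots> = (\<Sum>i\<in>{1..r}. \<Sum>l\<in>?L. \<Sum>j\<in>{1..s}. int (count (M i j) l))"
    by (rule sum.swap)
  also have "\<dots> = (\<Sum>i\<in>{1..r}. \<Sum>j\<in>{1..s}. \<Sum>l\<in>?L. int (count (M i j) l))"
    by (intro sum.cong refl sum.swap)
  also have "\<dots> = int r * int s * int lam"
    using cellM by simp
  finally have sm: "sum m ?L = int r * int s * int lam" .
  have sA: "sum A ?L = int r * (int lam * int n - int lam * int s)"
    using x(2) unfolding A_def by (subst sum.swap) simp
  have sB: "sum B ?L = int s * (int lam * int n - int lam * int r)"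
    using y(2) unfolding B_def by (subst sum.swap) simp
  have sD: "sum D ?L = (int n - int s) * (int lam * (int n - int r))"
    unfolding D_def sum_subtractf \<rho> sm sA sB by (simp add: power2_eq_square algebra_simps)
  have sum0: "(\<Sum>i\<in>{0..r}. f i) = f 0 + (\<Sum>i\<in>{1..r}. f i)" for f :: "nat \<Rightarrow> int"
    by (simp add: sum.atLeast_Suc_atMost)
  \<comment> \<open>Multiplicities between rows and symbols in the merged column; \<open>w j\<close> is the part assigned to
    column \<open>j\<close>.\<close>
  define z1 where "z1 i l = (if i = 0 then D l else x i l)" for i l
  have "\<exists>w. (\<forall>j\<in>{Suc s..n}. \<forall>i\<in>{0..r}. \<forall>l\<in>?L. 0 \<le> w j i l) \<and>
      (\<forall>i\<in>{0..r}. \<forall>l\<in>?L. (\<Sum>j\<in>{Suc s..n}. w j i l) = z1 i l) \<and>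
      (\<forall>j\<in>{Suc s..n}. \<forall>i\<in>{0..r}. (\<Sum>l\<in>?L. w j i l) =
          (if i = 0 then int lam * (int n - int r) else int lam)) \<and>
      (\<forall>j\<in>{Suc s..n}. \<forall>l\<in>?L. (\<Sum>i\<in>{0..r}. w j i l) \<le> int lam)"
  proof (rule bounded_decomposition)
    show "0 \<le> z1 i l" if "i \<in> {0..r}" "l \<in> ?L" for i l
      using that x(1) D0 by (auto simp: z1_def)
    show "(\<Sum>l\<in>?L. z1 i l) =
        int (card {Suc s..n}) * (if i = 0 then int lam * (int n - int r) else int lam)"
      if "i \<in> {0..r}" for i
      using that x(2)[of i] sD rs by (simp add: z1_def of_nat_diff algebra_simps)
    show "(\<Sum>i\<in>{0..r}. z1 i l) \<le> int (card {Suc s..n}) * int lam" if "l \<in> ?L" for l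
      unfolding sum0 using DA[OF that] rs by (simp add: z1_def A_def of_nat_diff)
  qed simp_all
  then obtain w where
    w: "\<And>j i l. j \<in> {Suc s..n} \<Longrightarrow> i \<in> {0..r} \<Longrightarrow> l \<in> ?L \<Longrightarrow> 0 \<le> w j i l"
      "\<And>i l. i \<in> {0..r} \<Longrightarrow> l \<in> ?L \<Longrightarrow> (\<Sum>j\<in>{Suc s..n}. w j i l) = z1 i l"
      "\<And>j i. j \<in> {Suc s..n} \<Longrightarrow> i \<in> {0..r} \<Longrightarrow> (\<Sum>l\<in>?L. w j i l) =
          (if i = 0 then int lam * (int n - int r) else int lam)"
      "\<And>j l. j \<in> {Suc s..n} \<Longrightarrow> l \<in> ?L \<Longrightarrow> (\<Sum>i\<in>{0..r}. w j i l) \<le> int lam"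
    by blast
  \<comment> \<open>Multiplicities between columns and symbols in the merged row, the columns beyond \<open>s\<close> being known
    from the first decomposition; \<open>v i\<close> is the part assigned to row \<open>i\<close>.\<close>
  define z2 where "z2 j l = (if j \<le> s then y j l else w j 0 l)" for j l
  have "\<exists>v. (\<forall>i\<in>{Suc r..n}. \<forall>j\<in>{1..n}. \<forall>l\<in>?L. 0 \<le> v i j l) \<and>
      (\<forall>j\<in>{1..n}. \<forall>l\<in>?L. (\<Sum>i\<in>{Suc r..n}. v i j l) = z2 j l) \<and>
      (\<forall>i\<in>{Suc r..n}. \<forall>j\<in>{1..n}. (\<Sum>l\<in>?L. v i j l) = int lam) \<and>
      (\<forall>i\<in>{Suc r..n}. \<forall>l\<in>?L. (\<Sum>j\<in>{1..n}. v i j l) \<le> int lam)"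
  proof (rule bounded_decomposition)
    show "0 \<le> z2 j l" if "j \<in> {1..n}" "l \<in> ?L" for j l
      using that y(1) w(1) by (auto simp: z2_def)
    show "(\<Sum>l\<in>?L. z2 j l) = int (card {Suc r..n}) * int lam" if "j \<in> {1..n}" for j
      using that y(2)[of j] w(3)[of j 0] rs by (cases "j \<le> s") (simp_all add: z2_def of_nat_diff algebra_simps)
    show "(\<Sum>j\<in>{1..n}. z2 j l) \<le> int (card {Suc r..n}) * int lam" if "l \<in> ?L" for l
      unfolding sum_split_at[OF rs(2)]
      using DB[OF that] w(2)[of 0 l] that rs by (simp add: z1_def z2_def B_def of_nat_diff)
  qed simp_all
  then obtain v where
    v: "\<And>i j l. i \<in> {Suc r..n} \<Longrightarrow> j \<in> {1..n} \<Longrightarrow> l \<in> ?L \<Longrightarrow> 0 \<le> v i j l"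
      "\<And>j l. j \<in> {1..n} \<Longrightarrow> l \<in> ?L \<Longrightarrow> (\<Sum>i\<in>{Suc r..n}. v i j l) = z2 j l"
      "\<And>i j. i \<in> {Suc r..n} \<Longrightarrow> j \<in> {1..n} \<Longrightarrow> (\<Sum>l\<in>?L. v i j l) = int lam"
      "\<And>i l. i \<in> {Suc r..n} \<Longrightarrow> l \<in> ?L \<Longrightarrow> (\<Sum>j\<in>{1..n}. v i j l) \<le> int lam"
    by blast
  define N where "N i j = (if i \<le> r then if j \<le> s then M i j else mset_of_counts ?L (\<lambda>l. w j i l)
      else mset_of_counts ?L (\<lambda>l. v i j l))" for i j
  define c where "c i j l = int (count (N i j) l)" for i j l
  have cM: "c i j l = int (count (M i j) l)" if "i \<in> {1..r}" "j \<in> {1..s}" for i j l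
    using that by (simp add: c_def N_def)
  have cw: "c i j l = w j i l" if "i \<in> {1..r}" "j \<in> {Suc s..n}" "l \<in> ?L" for i j l
    using that w(1)[of j i l] by (simp add: c_def N_def count_mset_of_counts)
  have cv: "c i j l = v i j l" if "i \<in> {Suc r..n}" "j \<in> {1..n}" "l \<in> ?L" for i j l
    using that v(1)[of i j l] by (simp add: c_def N_def count_mset_of_counts)
  have setN: "set_mset (N i j) \<subseteq> ?L" if "i \<in> {1..n}" "j \<in> {1..n}" for i j
    using that cellM(2)[of i j] set_mset_of_counts[of ?L] by (simp add: N_def)
  have cell: "int (size (N i j)) = int lam" if ij: "i \<in> {1..n}" "j \<in> {1..n}" for i j
  proof -
    consider "i \<in> {1..r}" "j \<in> {1..s}" | "i \<in> {1..r}" "j \<in> {Suc s..n}" | "i \<in> {Suc r..n}"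
      using ij by fastforce
    then have "(\<Sum>l\<in>?L. c i j l) = int lam"
      using cellM(1) w(3)[of j i] v(3)[of i j] ij by cases (simp_all add: cM cw cv)
    then show ?thesis using size_eq_sum_count[of ?L "N i j"] setN[OF ij] by (simp add: c_def)
  qed
  have right: "(\<Sum>j\<in>{Suc s..n}. c i j l) = x i l" if "i \<in> {1..r}" "l \<in> ?L" for i l
    using that w(2)[of i l] by (simp add: cw z1_def)
  have below: "(\<Sum>i\<in>{Suc r..n}. c i j l) = z2 j l" if "j \<in> {1..n}" "l \<in> ?L" for j l
    using that v(2)[of j l] by (simp add: cv)
  have row: "(\<Sum>j\<in>{1..n}. c i j l) \<le> int lam" if "i \<in> {1..n}" "l \<in> ?L" for i l
  proof (cases "i \<le> r")
    case True
    then have "(\<Sum>j\<in>{1..s}. c i j l) = int (row_occ s M i l)"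
      using that by (simp add: row_occ_def cM)
    then show ?thesis
      unfolding sum_split_at[OF rs(2)] using True that x(1)[of i l] right[of i l] by simp
  next
    case False
    then show ?thesis using that v(4)[of i l] by (simp add: cv)
  qed
  have col: "(\<Sum>i\<in>{1..n}. c i j l) \<le> int lam" if "j \<in> {1..n}" "l \<in> ?L" for j l
  proof (cases "j \<le> s")
    case True
    then have "(\<Sum>i\<in>{1..r}. c i j l) = int (col_occ r M j l)"
      using that by (simp add: col_occ_def cM)
    then show ?thesis
      unfolding sum_split_at[OF rs(1)] using True that y(1)[of j l] below[of j l] by (simp add: z2_def)
  next
    case False
    then have "(\<Sum>i\<in>{1..r}. c i j l) = (\<Sum>i\<in>{1..r}. w j i l)"
      using that by (simp add: cw)
    then show ?thesis
      unfolding sum_split_at[OF rs(1)] using False that w(4)[of j l] below[of j l]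
      by (simp add: z2_def sum0)
  qed
  have tot: "(\<Sum>i\<in>{1..n}. \<Sum>j\<in>{1..n}. c i j l) = \<rho> l" if "l \<in> ?L" for l
  proof -
    have "(\<Sum>i\<in>{1..r}. \<Sum>j\<in>{1..n}. c i j l) = m l + A l"
      unfolding sum_split_at[OF rs(2)] sum.distrib
      using that by (simp add: right cM m_def occ_def A_def)
    moreover have "(\<Sum>i\<in>{Suc r..n}. \<Sum>j\<in>{1..n}. c i j l) = B l + D l"
      using that below w(2)[of 0 l]
      by (subst sum.swap) (simp add: sum_split_at[OF rs(2), simplified] z2_def z1_def B_def rs)
    ultimately show ?thesis unfolding sum_split_at[OF rs(1)] by (simp add: D_def)
  qed
  have "latin_square n k \<rho> lam N"
    unfolding latin_square_def lam_matrix_def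
  proof (intro conjI ballI)
    show "size (N i j) = lam" if "i \<in> {1..n}" "j \<in> {1..n}" for i j using cell[OF that] by simp
    show "int (occ n n N l) = \<rho> l" if "l \<in> ?L" for l
      using tot[OF that] by (simp add: occ_def c_def)
    show "row_occ n N i l \<le> lam" if "l \<in> ?L" "i \<in> {1..n}" for i l
      using row[OF that(2,1)] by (simp add: row_occ_def c_def flip: of_nat_sum)
    show "col_occ n N j l \<le> lam" if "l \<in> ?L" "j \<in> {1..n}" for j l
      using col[OF that(2,1)] by (simp add: col_occ_def c_def flip: of_nat_sum)
  qed (use setN in auto)
  moreover have "extends r s M N" by (simp add: extends_def N_def)
  ultimately show ?thesis by blast
qed

theorem theorem1p1:
  fixes r s n k lam :: nat and \<rho> :: "nat \<Rightarrow> int" and M :: array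
  assumes "0 < n" and "0 < k" and "0 < lam"
    and "max r s \<le> n" and "n \<le> k"
    and "\<forall>l\<in>{1..k}. 1 \<le> \<rho> l \<and> \<rho> l \<le> int lam * int n"
    and "(\<Sum>l\<in>{1..k}. \<rho> l) = int lam * (int n)\<^sup>2"
    and "latin_rectangle r s k \<rho> lam M"
  shows "(\<exists>N. latin_square n k \<rho> lam N \<and> extends r s M N) \<longleftrightarrow> admissible r s n k \<rho> lam M"
  using assms extension_imp_admissible admissible_imp_extension
  by (metis max.bounded_iff)

end
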